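(* Let $G$ be a non-cyclic finite group of order $n$ and let $q$ be the smallest prime divisor of $n$. Then $$\psi(G)<\frac{1}{q-1}\,\psi(C_n).$$
   Context: For a finite group $G$, $\psi(G)=\sum_{g\in G} o(g)$ denotes the sum of the orders of all elements of $G$. $C_n$ denotes the cyclic group of order $n$. *)

theory Defs
  imports "HOL-Algebra.Algebra" "HOL-Computational_Algebra.Primes"
begin

definition psi :: "('a, 'b) monoid_scheme \<Rightarrow> nat" where
  "psi G = (\<Sum>g\<in>carrier G. group.ord G g)"

end

theory Submission
  imports Defs "HOL-Number_Theory.Totient"
begin

text \<open>
  Let \<open>\<Psi>(n) = \<psi>(C\<^sub>n)\<close>, which is multiplicative, let \<open>p\<close> be the largest prime divisor of \<open>n = |G|\<close>, and
  suppose \<open>(q - 1) \<psi>(G) \<ge> \<Psi>(n)\<close>. Since \<open>\<Psi>(n) \<ge> n\<^sup>2 q / (p + 1)\<close>, some cyclic subgroup has index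
  less than \<open>p\<close>; it contains all \<open>p\<close>-elements, so \<open>G\<close> has a normal cyclic Sylow \<open>p\<close>-subgroup \<open>P\<close>.
  A coset \<open>C\<close> of \<open>P\<close>, of order \<open>d\<close> in \<open>G/P\<close>, contributes at most \<open>d \<psi>(P)\<close> to \<open>\<psi>(G)\<close>, and at most
  \<open>d |P|\<close> if it does not centralise \<open>P\<close>. If \<open>G/P\<close> is not cyclic, the first bound and induction suffice.
  If \<open>G/P\<close> is cyclic of order \<open>m\<close>, then \<open>P\<close> is not central, so the centralising cosets lie in the
  subgroup of order \<open>m/r\<close> for some prime \<open>r\<close>, and \<open>\<Psi>(m/r) \<le> \<Psi>(m) / (r\<^sup>2 - r + 1)\<close> gives the claim.
\<close>

section \<open>Sums of element orders of cyclic groups\<close>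

text \<open>In a cyclic group of order \<open>n > 0\<close> each divisor \<open>d\<close> of
  \<open>n\<close> is the order of exactly \<open>totient d\<close> elements.\<close>

definition cyclic_psi :: "nat \<Rightarrow> nat" where
  "cyclic_psi n = (\<Sum>d | d dvd n. d * totient d)"

lemma cyclic_psi_pos:
  assumes "n > 0"
  shows "cyclic_psi n > 0"
proof -
  have "(1::nat) * totient 1 \<le> cyclic_psi n"
    unfolding cyclic_psi_def using assms by (intro member_le_sum) auto
  then show ?thesis by simp
qed

text \<open>A divisor of \<open>a * b\<close> splits uniquely into a divisor of \<open>a\<close> and
  a divisor of \<open>b\<close>, and \<open>totient\<close> is multiplicative on these coprime
  factors.\<close>

lemma cyclic_psi_mult_coprime:
  assumes "coprime a b" "a > 0" "b > 0"
  shows "cyclic_psi (a * b) = cyclic_psi a * cyclic_psi b"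
proof -
  have cop: "coprime x y" if "x dvd a" "y dvd b" for x y
    using assms(1) that coprime_divisors by blast
  \<comment> \<open>The gcd with \<open>a\<close> recovers the first factor from the product, which
    makes the splitting unique.\<close>
  have fst_eq: "gcd (x * y) a = x" if "x dvd a" "y dvd b" for x y
  proof -
    have "coprime y a"
      using assms(1) that(2) coprime_commute coprime_divisors dvd_refl by metis
    then show ?thesis
      using that(1) by (simp add: gcd_mult_left_right_cancel coprime_commute)
  qed
  have bij: "bij_betw (\<lambda>(x, y). x * y) ({d. d dvd a} \<times> {d. d dvd b}) {d. d dvd a * b}"
    unfolding bij_betw_def
  proof
    show "inj_on (\<lambda>(x, y). x * y) ({d. d dvd a} \<times> {d. d dvd b})"
    proof (rule inj_onI, clarify)
      fix x y x' y' assume d: "x dvd a" "y dvd b" "x' dvd a" "y' dvd b" and eq: "x * y = x' * y'"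
      have "x = x'" using fst_eq[OF d(1,2)] fst_eq[OF d(3,4)] eq by simp
      moreover have "x > 0" using d(1) assms(2) dvd_pos_nat by blast
      ultimately show "x = x' \<and> y = y'" using eq by simp
    qed
    show "(\<lambda>(x, y). x * y) ` ({d. d dvd a} \<times> {d. d dvd b}) = {d. d dvd a * b}"
    proof (intro equalityI subsetI)
      fix z assume "z \<in> {d. d dvd a * b}"
      then obtain x y where "z = x * y" "x dvd a" "y dvd b"
        using division_decomp by blast
      then show "z \<in> (\<lambda>(x, y). x * y) ` ({d. d dvd a} \<times> {d. d dvd b})" by force
    qed (auto intro: mult_dvd_mono)
  qed
  have "cyclic_psi (a * b) = (\<Sum>(x, y) \<in> {d. d dvd a} \<times> {d. d dvd b}. (x * y) * totient (x * y))"
    unfolding cyclic_psi_def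
    by (subst sum.reindex_bij_betw[OF bij, symmetric]) (simp add: case_prod_unfold)
  also have "\<dots> = (\<Sum>(x, y) \<in> {d. d dvd a} \<times> {d. d dvd b}. (x * totient x) * (y * totient y))"
    by (rule sum.cong) (auto simp: totient_mult_coprime cop)
  also have "\<dots> = cyclic_psi a * cyclic_psi b"
    unfolding cyclic_psi_def sum_product sum.cartesian_product ..
  finally show ?thesis .
qed

text \<open>The sum 1 + (p - 1)(p + p^3 + ... + p^(2a-1)) telescopes after multiplication by p + 1;
  keeping that factor on the left avoids division.\<close>

lemma cyclic_psi_prime_power:
  fixes p :: nat
  assumes "Factorial_Ring.prime p"
  shows "(p + 1) * cyclic_psi (p ^ a) = p ^ (2 * a + 1) + 1"
proof (induction a)
  case 0
  then show ?case by (simp add: cyclic_psi_def)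
next
  case (Suc a)
  have p: "p > 1" using assms by (rule prime_gt_1_nat)
  have div: "{d. d dvd p ^ k} = (\<lambda>i. p ^ i) ` {..k}" for k
    using divides_primepow_nat[OF assms] by auto
  have inj: "inj_on (\<lambda>i. p ^ i) A" for A
    using p by (auto intro!: inj_onI)
  have sums: "cyclic_psi (p ^ k) = (\<Sum>i\<le>k. p ^ i * totient (p ^ i))" for k
    unfolding cyclic_psi_def div by (subst sum.reindex[OF inj]) simp
  have "cyclic_psi (p ^ Suc a) = cyclic_psi (p ^ a) + p ^ Suc a * (p ^ a * (p - 1))"
    unfolding sums by (simp add: totient_prime_power_Suc[OF assms, of a, simplified])
  then have "(p + 1) * cyclic_psi (p ^ Suc a)
      = (p + 1) * cyclic_psi (p ^ a) + (p + 1) * (p ^ Suc a * (p ^ a * (p - 1)))"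
    by (simp only: distrib_left)
  also have "\<dots> = p ^ (2 * a + 1) + 1 + p ^ (2 * a + 1) * ((p + 1) * (p - 1))"
  proof -
    have "p ^ (2 * a + 1) = p ^ Suc a * p ^ a" by (simp add: power_add mult_2)
    then have "(p + 1) * (p ^ Suc a * (p ^ a * (p - 1))) = p ^ (2 * a + 1) * ((p + 1) * (p - 1))"
      by (simp only: mult_ac)
    then show ?thesis using Suc.IH by simp
  qed
  also have "(p + 1) * (p - 1) = p ^ 2 - 1"
    by (simp add: algebra_simps power2_eq_square)
  also have "p ^ (2 * a + 1) + 1 + p ^ (2 * a + 1) * (p ^ 2 - 1) = p ^ (2 * Suc a + 1) + 1"
  proof -
    have "p ^ 2 - 1 + 1 = p ^ 2" using p by simp
    then have "p ^ (2 * a + 1) + p ^ (2 * a + 1) * (p ^ 2 - 1) = p ^ (2 * a + 1) * p ^ 2"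
      by (metis add.commute mult.right_neutral distrib_left)
    then show ?thesis by (simp add: power_add power2_eq_square)
  qed
  finally show ?case .
qed

text \<open>A prime power r^k contributes at least r^(2k) * r/(r + 1), and the product of r/(r + 1)
  over all integers r from \<open>q\<close> to \<open>p\<close> telescopes to q/(p + 1). Hence the
  induction runs over all integers \<open>p\<close>, prime or not.\<close>

lemma cyclic_psi_lower_bound:
  fixes p q n :: nat
  assumes "q \<le> p + 1" "n > 0" "\<And>r. Factorial_Ring.prime r \<Longrightarrow> r dvd n \<Longrightarrow> q \<le> r \<and> r \<le> p"
  shows "q * n ^ 2 \<le> (p + 1) * cyclic_psi n"
  using assms
proof (induction p arbitrary: n)
  case 0
  have "\<not> (\<exists>r. Factorial_Ring.prime r \<and> r dvd n)"
    using 0(3) prime_gt_0_nat by (metis leD)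
  then have "n = 1" using prime_factor_nat by blast
  with 0 show ?case by (simp add: cyclic_psi_def)
next
  case (Suc p)
  show ?case
  proof (cases "Factorial_Ring.prime (Suc p) \<and> Suc p dvd n")
    case False
    show ?thesis
    proof (cases "q \<le> p + 1")
      case True
      then have "q * n ^ 2 \<le> (p + 1) * cyclic_psi n"
        using Suc.prems(2,3) \<open>\<not> (Factorial_Ring.prime (Suc p) \<and> Suc p dvd n)\<close>
        by (intro Suc.IH) (auto simp: le_Suc_eq)
      then show ?thesis by simp
    next
      case False
      \<comment> \<open>Here \<open>q\<close> equals \<open>p + 2\<close>, so no integer lies
        between \<open>q\<close> and \<open>Suc p\<close>.\<close>
      then have "\<not> (\<exists>r. Factorial_Ring.prime r \<and> r dvd n)"
        by (auto dest!: Suc.prems(3))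
      then have "n = 1" using prime_factor_nat by blast
      with Suc.prems(1) show ?thesis by (simp add: cyclic_psi_def)
    qed
  next
    case True
    define P where "P = Suc p"
    have P: "Factorial_Ring.prime P" "P dvd n" using True by (auto simp: P_def)
    obtain k m where n: "n = P ^ k * m" "\<not> P dvd m"
      using prime_power_canonical[OF P(1) \<open>n > 0\<close>] by (metis mult.commute)
    have m: "m > 0" using n \<open>n > 0\<close> by (metis gr0I mult_0_right)
    have "coprime (P ^ k) m"
      using P(1) n(2) by (simp add: prime_imp_coprime coprime_power_left_iff)
    then have mult: "cyclic_psi n = cyclic_psi (P ^ k) * cyclic_psi m"
      using n(1) m prime_gt_0_nat[OF P(1)] by (simp add: cyclic_psi_mult_coprime)
    have "q \<le> P" using Suc.prems(3) P by blast
    \<comment> \<open>The primes of \<open>m\<close> are at most \<open>p = P - 1\<close>; the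
      factor \<open>p + 1 = P\<close> of this bound is absorbed by the odd power of \<open>P\<close>
      in the formula for \<open>cyclic_psi (P ^ k)\<close>.\<close>
    have "q * m ^ 2 \<le> (p + 1) * cyclic_psi m"
    proof (rule Suc.IH)
      show "q \<le> p + 1" using \<open>q \<le> P\<close> by (simp add: P_def)
      show "q \<le> r \<and> r \<le> p" if "Factorial_Ring.prime r" "r dvd m" for r
      proof -
        have "r \<noteq> P" using that n(2) by auto
        moreover have "q \<le> r \<and> r \<le> Suc p" using Suc.prems(3)[of r] that n(1) by auto
        ultimately show ?thesis by (auto simp: P_def)
      qed
    qed (rule m)
    then have IH: "q * m ^ 2 \<le> P * cyclic_psi m" by (simp add: P_def)
    have "q * n ^ 2 = P ^ (2 * k) * (q * m ^ 2)"
      by (simp add: n(1) power_mult_distrib power_mult[symmetric] mult.commute mult.left_commute)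
    also have "\<dots> \<le> P ^ (2 * k) * (P * cyclic_psi m)" using IH by (rule mult_left_mono) simp
    also have "\<dots> = P ^ (2 * k + 1) * cyclic_psi m" by simp
    also have "\<dots> \<le> ((P + 1) * cyclic_psi (P ^ k)) * cyclic_psi m"
      unfolding cyclic_psi_prime_power[OF P(1)] by (rule mult_right_mono) auto
    also have "\<dots> = (Suc p + 1) * cyclic_psi n" by (simp add: mult P_def algebra_simps)
    finally show ?thesis .
  qed
qed

text \<open>This is \<open>(r\<^sup>2 - r + 1) \<Psi>(m/r) \<le> \<Psi>(m)\<close>, arranged without subtraction.\<close>
lemma cyclic_psi_div_prime:
  fixes r m :: nat
  assumes r: "Factorial_Ring.prime r" "r dvd m" and "m > 0"
  shows "(r ^ 2 + 1) * cyclic_psi (m div r) \<le> cyclic_psi m + r * cyclic_psi (m div r)"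
proof -
  obtain k t where m: "m = r ^ k * t" "\<not> r dvd t"
    using prime_power_canonical[OF r(1) \<open>m > 0\<close>] by (metis mult.commute)
  have t: "t > 0" using m \<open>m > 0\<close> by (metis gr0I mult_0_right)
  have r0: "r > 1" using prime_gt_1_nat[OF r(1)] .
  obtain c where c: "k = Suc c" using m r(2) by (cases k) auto
  have cop: "coprime (r ^ j) t" for j
    using r(1) m(2) by (simp add: prime_imp_coprime coprime_power_left_iff)
  have "m div r = r ^ c * t" using m(1) c r0 by simp
  then have psi1: "cyclic_psi (m div r) = cyclic_psi (r ^ c) * cyclic_psi t"
    using cop t r0 by (simp add: cyclic_psi_mult_coprime)
  have psi2: "cyclic_psi m = cyclic_psi (r ^ Suc c) * cyclic_psi t"
    using cop[of "Suc c"] t r0 unfolding m(1) c by (intro cyclic_psi_mult_coprime) auto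
  have "(r + 1) * ((r ^ 2 + 1) * cyclic_psi (r ^ c)) = (r ^ 2 + 1) * (r ^ (2 * c + 1) + 1)"
    using cyclic_psi_prime_power[OF r(1), of c] by (metis mult.left_commute)
  also have "\<dots> \<le> r ^ (2 * Suc c + 1) + 1 + r * (r ^ (2 * c + 1) + 1)"
  proof -
    define x where "x = r ^ (2 * c)"
    have "x \<ge> 1" using r0 by (simp add: x_def)
    then obtain y where y: "x = y + 1" by (metis add.commute le_Suc_ex)
    obtain s where s: "r = s + 1" using r0 by (metis add.commute less_imp_add_positive)
    \<comment> \<open>The right side exceeds the left by r(r - 1)(x - 1); in terms of
      \<open>s\<close> and \<open>y\<close> this has only nonnegative coefficients.\<close>
    have "(r ^ 2 + 1) * (r * x + 1) \<le> r ^ 3 * x + 1 + r * (r * x + 1)"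
      unfolding y s by (simp add: power2_eq_square power3_eq_cube algebra_simps)
    then show ?thesis by (simp add: x_def power3_eq_cube power2_eq_square algebra_simps)
  qed
  also have "\<dots> = (r + 1) * (cyclic_psi (r ^ Suc c) + r * cyclic_psi (r ^ c))"
    using cyclic_psi_prime_power[OF r(1), of c] cyclic_psi_prime_power[OF r(1), of "Suc c"]
    by (metis distrib_left mult.left_commute)
  finally have "(r ^ 2 + 1) * cyclic_psi (r ^ c) \<le> cyclic_psi (r ^ Suc c) + r * cyclic_psi (r ^ c)"
    by (simp only: mult_le_cancel1)
  then have "((r ^ 2 + 1) * cyclic_psi (r ^ c)) * cyclic_psi t
      \<le> (cyclic_psi (r ^ Suc c) + r * cyclic_psi (r ^ c)) * cyclic_psi t"
    by (rule mult_right_mono) simp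
  then show ?thesis unfolding psi1 psi2 by (simp add: algebra_simps)
qed

text \<open>As \<open>cyclic_psi p\<close> is p^2 - p + 1, this says that the ratio of
  \<open>p ^ a\<close> to \<open>cyclic_psi (p ^ a)\<close> is largest for
  \<open>a = 1\<close>.\<close>

lemma prime_power_over_cyclic_psi_le:
  fixes p :: nat
  assumes p: "Factorial_Ring.prime p" and "a > 0"
  shows "real (p ^ a) * (real p ^ 2 - real p + 1) \<le> real p * real (cyclic_psi (p ^ a))"
proof -
  define t where "t = real (p ^ a)"
  define u where "u = real p"
  have u: "u > 1" using prime_gt_1_nat[OF p] by (simp add: u_def)
  have "p ^ 1 \<le> p ^ a" using assms prime_gt_0_nat[OF p] by (intro power_increasing) auto
  then have t: "t \<ge> u" unfolding t_def u_def by (simp del: of_nat_power)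
  have psi: "(u + 1) * real (cyclic_psi (p ^ a)) = u * t ^ 2 + 1"
    using arg_cong[OF cyclic_psi_prime_power[OF p, of a], of real]
    by (simp add: u_def t_def power_mult[symmetric] algebra_simps)
  have "1 * 1 \<le> u ^ 2 * t" using u t by (intro mult_mono) auto
  \<comment> \<open>This product is exactly the difference of the two sides after multiplication by
    \<open>u + 1\<close>.\<close>
  then have "0 \<le> (t - u) * (u ^ 2 * t - 1)" using t by (intro mult_nonneg_nonneg) auto
  then have "(u + 1) * (t * (u ^ 2 - u + 1)) \<le> u * (u * t ^ 2 + 1)"
    by (simp add: power2_eq_square algebra_simps)
  also have "\<dots> = (u + 1) * (u * real (cyclic_psi (p ^ a)))"
    by (metis psi mult.left_commute)
  finally show ?thesis using u by (simp add: t_def u_def)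
qed

section \<open>Orders of elements in cyclic groups\<close>

context group
begin

lemma mem_generate_iff_nat_pow:
  assumes "g \<in> carrier G" "ord g > 0"
  shows "x \<in> generate G {g} \<longleftrightarrow> (\<exists>i::nat. x = g [^] i)"
  using generate_pow_nat[OF assms(1)] assms(2) by simp

text \<open>The elements killed by \<open>k\<close> are those whose order divides \<open>k\<close>,
  and each divisor \<open>d\<close> is the order of \<open>totient d\<close> of them. The version
  with \<open>k\<close> is needed to sum over a subgroup of a cyclic quotient.\<close>

lemma sum_ord_cyclic:
  assumes g: "g \<in> carrier G" "ord g > 0" and k: "k dvd ord g"
  shows "(\<Sum>x \<in> {x \<in> generate G {g}. x [^] k = \<one>}. ord x) = cyclic_psi k"
proof -
  define n where "n = ord g"
  define H where "H = generate G {g}"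
  have n: "n > 0" and kn: "k dvd n" using assms by (auto simp: n_def)
  have H_carrier: "H \<subseteq> carrier G"
    unfolding H_def using g(1) by (intro generate_incl) auto
  have card_H: "card H = n"
    unfolding H_def n_def using generate_pow_card[OF g(1)] by simp
  have fin: "finite H" using card_H n card_gt_0_iff by metis
  have inj: "inj_on (\<lambda>i. g [^] i) {0<..n}"
    using ord_inj'[OF g(1)] unfolding n_def by (rule inj_on_subset) auto
  have "(\<lambda>i. g [^] i) ` {0<..n} \<subseteq> H"
    using generate_pow_nat[OF g(1)] g(2) unfolding H_def by auto
  moreover have "card ((\<lambda>i. g [^] i) ` {0<..n}) = card H"
    using card_image[OF inj] card_H by simp
  ultimately have H: "H = (\<lambda>i. g [^] i) ` {0<..n}"
    using fin card_subset_eq by metis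
  have count: "card {x \<in> H. ord x = d} = totient d" if d: "d dvd n" for d
  proof -
    have d0: "d > 0" using d n dvd_pos_nat by blast
    have "{x \<in> H. ord x = d} = (\<lambda>i. g [^] i) ` {i \<in> {0<..n}. ord (g [^] i) = d}"
      unfolding H by auto
    \<comment> \<open>Fixing the order of a power means fixing the gcd of its exponent with
      \<open>n\<close>, and such exponents in \<open>{0<..n}\<close> are counted by
      \<open>totient\<close>.\<close>
    moreover have "(ord (g [^] i) = d) = (gcd i n = n div d)" if "i \<in> {0<..n}" for i
    proof -
      have "ord (g [^] i) = n div gcd i n"
        using that by (simp add: ord_pow_gen[OF g(1)] n_def gcd.commute)
      moreover have "(n div gcd i n = d) = (gcd i n = n div d)"
      proof -
        obtain s t where "n = gcd i n * s" "n = d * t"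
          using d by (meson dvdE gcd_dvd2)
        moreover have "gcd i n > 0" using n by simp
        ultimately show ?thesis using d0 n
          by (metis mult.commute nonzero_mult_div_cancel_left nonzero_mult_div_cancel_right neq0_conv)
      qed
      ultimately show ?thesis by simp
    qed
    ultimately have "{x \<in> H. ord x = d} = (\<lambda>i. g [^] i) ` {i \<in> {0<..n}. gcd i n = n div d}"
      by auto
    then have "card {x \<in> H. ord x = d} = card {i \<in> {0<..n}. gcd i n = n div d}"
      by (simp only:) (rule card_image[OF inj_on_subset[OF inj]], auto)
    also have "\<dots> = totient (n div (n div d))"
      using n d by (intro card_gcd_eq_totient) (auto simp: div_dvd_iff_mult)
    also have "n div (n div d) = d" using d n 
      by (metis div_div_eq_right div_self dvd_refl less_irrefl mult_1)
    finally show ?thesis .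
  qed
  have k0: "k > 0" using kn n dvd_pos_nat by blast
  define S where "S = {x \<in> H. x [^] k = \<one>}"
  have S: "x \<in> S \<longleftrightarrow> x \<in> H \<and> ord x dvd k" for x
    unfolding S_def using H_carrier pow_eq_id by auto
  have finS: "finite S" using fin by (simp add: S_def)
  have "(\<Sum>x \<in> S. ord x) = (\<Sum>d | d dvd k. \<Sum>x \<in> {x. x \<in> S \<and> ord x = d}. ord x)"
    using finS k0 by (intro sum.group[symmetric]) (auto simp: S)
  also have "\<dots> = (\<Sum>d | d dvd k. d * totient d)"
  proof (rule sum.cong[OF refl])
    fix d assume "d \<in> {d. d dvd k}"
    then have d: "d dvd k" "d dvd n" using kn dvd_trans by auto
    have "{x. x \<in> S \<and> ord x = d} = {x \<in> H. ord x = d}" using d(1) by (auto simp: S)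
    then show "(\<Sum>x \<in> {x. x \<in> S \<and> ord x = d}. ord x) = d * totient d"
      using count[OF d(2)] by simp
  qed
  finally show ?thesis by (simp add: S_def H_def cyclic_psi_def)
qed

lemma sum_ord_generate:
  assumes "g \<in> carrier G" "ord g > 0"
  shows "(\<Sum>x \<in> generate G {g}. ord x) = cyclic_psi (ord g)"
proof -
  have "x [^] ord g = \<one>" if x: "x \<in> generate G {g}" for x
  proof -
    obtain i :: nat where "x = g [^] i"
      using x mem_generate_iff_nat_pow[OF assms] by blast
    then have "x [^] ord g = g [^] (i * ord g)" using assms(1) by (simp add: nat_pow_pow)
    then show ?thesis using pow_eq_id[OF assms(1), of "i * ord g"] by simp
  qed
  then have "{x \<in> generate G {g}. x [^] ord g = \<one>} = generate G {g}" by auto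
  then show ?thesis using sum_ord_cyclic[OF assms dvd_refl] by simp
qed

lemma generate_eq_carrier_if_ord_eq_order:
  assumes "finite (carrier G)" "g \<in> carrier G" "ord g = order G"
  shows "generate G {g} = carrier G"
  using assms generate_incl[of "{g}"] generate_pow_card[OF assms(2)]
  by (intro card_subset_eq) (auto simp: order_def)

lemma cyclic_group_iff_ord_eq_order:
  assumes "finite (carrier G)"
  shows "cyclic_group G \<longleftrightarrow> (\<exists>g \<in> carrier G. ord g = order G)"
proof
  assume "cyclic_group G"
  then obtain g where "g \<in> carrier G" "subgroup_generated G {g} = G"
    unfolding cyclic_group_def by blast
  then show "\<exists>g \<in> carrier G. ord g = order G" using cyclic_order_is_ord by metis
next
  assume "\<exists>g \<in> carrier G. ord g = order G"
  then obtain g where g: "g \<in> carrier G" "ord g = order G" by blast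
  have "carrier G = range (\<lambda>n::int. g [^] n)"
    using generate_eq_carrier_if_ord_eq_order[OF assms g] generate_pow[OF g(1)]
    by (simp add: full_SetCompr_eq)
  then show "cyclic_group G" using g(1) cyclic_group by blast
qed

lemma psi_eq_cyclic_psi:
  assumes "finite (carrier G)" "g \<in> carrier G" "ord g = order G"
  shows "psi G = cyclic_psi (order G)"
proof -
  have "ord g > 0" using ord_ge_1[OF assms(1,2)] by simp
  then show ?thesis
    using sum_ord_generate[OF assms(2)] generate_eq_carrier_if_ord_eq_order[OF assms] assms(3)
    by (simp add: psi_def)
qed

lemma pow_card_subgroup_eq_one:
  assumes "subgroup K G" "x \<in> K"
  shows "x [^] card K = \<one>"
  using group.pow_order_eq_1[OF subgroup_imp_group[OF assms(1)], of x] assms(2)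
  by (simp add: order_def nat_pow_consistent[symmetric])

end

section \<open>The integers modulo n, and invariance of psi under isomorphism\<close>

lemma psi_integer_mod_group:
  assumes "n > 0"
  shows "psi (integer_mod_group n) = cyclic_psi n"
proof -
  interpret Z: group "integer_mod_group n" by simp
  have order: "order (integer_mod_group n) = n"
    using assms by (simp add: order_def carrier_integer_mod_group)
  have fin: "finite (carrier (integer_mod_group n))"
    using assms by (simp add: carrier_integer_mod_group)
  \<comment> \<open>The generator is reduced because for \<open>n = 1\<close> the only element is
    0.\<close>
  have g: "1 mod int n \<in> carrier (integer_mod_group n)"
    using assms by (simp add: carrier_integer_mod_group)
  have "Z.ord (1 mod int n) = n"
    unfolding Z.ord_unique[OF g]
    by (simp add: mod_mult_right_eq mod_eq_0_iff_dvd)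
  then show ?thesis using Z.psi_eq_cyclic_psi[OF fin g] order by simp
qed

lemma ord_iso:
  assumes "group G" "group H" "h \<in> iso G H" "x \<in> carrier G"
  shows "group.ord H (h x) = group.ord G x"
proof -
  interpret G: group G by fact
  interpret H: group H by fact
  have hom: "h \<in> hom G H" and bij: "bij_betw h (carrier G) (carrier H)"
    using assms(3) by (auto simp: iso_def)
  have hx: "h x \<in> carrier H" using hom assms(4) by (auto simp: hom_def)
  have "h x [^]\<^bsub>H\<^esub> n = \<one>\<^bsub>H\<^esub> \<longleftrightarrow> x [^]\<^bsub>G\<^esub> n = \<one>\<^bsub>G\<^esub>" for n :: nat
  proof -
    have "h x [^]\<^bsub>H\<^esub> n = h (x [^]\<^bsub>G\<^esub> n)"
      using hom_nat_pow[OF hom assms(4,1,2)] by simp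
    moreover have "h \<one>\<^bsub>G\<^esub> = \<one>\<^bsub>H\<^esub>" using hom_one[OF hom assms(1,2)] .
    ultimately show ?thesis
      using bij assms(4) by (metis G.nat_pow_closed G.one_closed bij_betw_imp_inj_on inj_onD)
  qed
  then show ?thesis using H.ord_unique[OF hx] G.pow_eq_id[OF assms(4)] by simp
qed

lemma psi_iso:
  assumes "group G" "group H" "h \<in> iso G H"
  shows "psi H = psi G"
proof -
  have bij: "bij_betw h (carrier G) (carrier H)" using assms(3) by (auto simp: iso_def)
  have "psi H = (\<Sum>x \<in> carrier G. group.ord H (h x))"
    unfolding psi_def by (rule sum.reindex_bij_betw[OF bij, symmetric])
  also have "\<dots> = psi G"
    unfolding psi_def by (rule sum.cong) (simp_all add: ord_iso[OF assms])
  finally show ?thesis .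
qed

section \<open>Normal cyclic Hall subgroups\<close>

text \<open>A normal cyclic Sylow \<open>p\<close>-subgroup, given by a generator \<open>c\<close>:
  conjugation then acts on it as a power map, and centralising it means commuting with
  \<open>c\<close>.\<close>

locale normal_cyclic_hall = group G for G (structure) +
  fixes c :: 'a and p a :: nat
  assumes finite_carrier: "finite (carrier G)"
    and c_closed: "c \<in> carrier G"
    and prime_p: "Factorial_Ring.prime p"
    and ord_c: "ord c = p ^ a"
    and normal_generate: "generate G {c} \<lhd> G"
    and coprime_index: "coprime p (order (G Mod generate G {c}))"
begin

abbreviation P where "P \<equiv> generate G {c}"
abbreviation Q where "Q \<equiv> G Mod P"

sublocale normal P G by (rule normal_generate)

sublocale Q: group Q by (rule factorgroup_is_group)

lemma ord_c_pos: "ord c > 0"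
  using ord_c prime_gt_0_nat[OF prime_p] by simp

lemma subgroup_P: "subgroup P G"
  by (rule subgroup_axioms)

lemma mem_P_iff: "x \<in> P \<longleftrightarrow> (\<exists>i::nat. x = c [^] i)"
  by (rule mem_generate_iff_nat_pow[OF c_closed ord_c_pos])

lemma c_mem: "c \<in> P"
  unfolding mem_P_iff using nat_pow_eone[OF c_closed] by metis

lemma pow_mem_P: "x \<in> P \<Longrightarrow> x [^] (i::nat) \<in> P"
  unfolding mem_P_iff using nat_pow_pow[OF c_closed] by metis

lemma P_pow_eq_one: "x \<in> P \<Longrightarrow> x [^] (p ^ a) = \<one>"
  using pow_card_subgroup_eq_one[OF subgroup_P] generate_pow_card[OF c_closed] ord_c by simp

lemma card_P: "card P = p ^ a"
  using generate_pow_card[OF c_closed] ord_c by simp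

lemma P_closed: "x \<in> P \<Longrightarrow> x \<in> carrier G"
  by (rule mem_carrier)

lemma carrier_Q: "carrier Q = rcosets P"
  by (simp add: FactGroup_def)

lemma finite_Q: "finite (carrier Q)"
  unfolding carrier_FactGroup using finite_carrier by simp

lemma order_Q: "order G = order Q * p ^ a"
  using lagrange[OF subgroup_P] card_P by (simp add: order_def carrier_Q)

lemma Q_ord_pos: "C \<in> carrier Q \<Longrightarrow> Q.ord C > 0"
  using Q.ord_ge_1[OF finite_Q] by fastforce

lemma coprime_ord_Q:
  assumes "C \<in> carrier Q"
  shows "coprime p (Q.ord C)"
  using coprime_index Q.ord_dvd_group_order[OF assms] coprime_divisors dvd_refl by blast

text \<open>By normality the conjugate of \<open>c\<close> by \<open>g\<close> is some
  \<open>c [^] k\<close>, and the same exponent then serves for every power of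
  \<open>c\<close>.\<close>

lemma conj_pow:
  assumes "g \<in> carrier G"
  obtains k :: nat where "\<And>x. x \<in> P \<Longrightarrow> g \<otimes> x = x [^] k \<otimes> g"
proof -
  have "g \<otimes> c \<otimes> inv g \<in> P" using inv_op_closed2[OF assms c_mem] .
  then obtain k :: nat where k: "g \<otimes> c \<otimes> inv g = c [^] k" using mem_P_iff by blast
  have "c [^] k \<otimes> g = g \<otimes> c \<otimes> (inv g \<otimes> g)"
    unfolding k[symmetric] using assms c_closed by (simp add: m_assoc)
  then have gc: "g \<otimes> c = c [^] k \<otimes> g" using assms c_closed by simp
  have "g \<otimes> c [^] j = c [^] (k * j) \<otimes> g" for j
  proof (induction j)
    case (Suc j)
    have "g \<otimes> c [^] Suc j = (g \<otimes> c [^] j) \<otimes> c" using assms c_closed by (simp add: m_assoc)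
    also have "\<dots> = c [^] (k * j) \<otimes> (g \<otimes> c)" using Suc assms c_closed by (simp add: m_assoc)
    also have "\<dots> = c [^] (k * j) \<otimes> c [^] k \<otimes> g" using gc assms c_closed by (simp add: m_assoc)
    also have "\<dots> = c [^] (k * Suc j) \<otimes> g" using c_closed by (simp add: nat_pow_mult add.commute)
    finally show ?case .
  qed (use assms in simp)
  then have "g \<otimes> x = x [^] k \<otimes> g" if "x \<in> P" for x
    using that c_closed unfolding mem_P_iff by (auto simp: nat_pow_pow mult.commute)
  then show thesis using that by blast
qed

text \<open>Moving \<open>g\<close> to the right past a power of \<open>x\<close> multiplies the
  exponent by \<open>k\<close>; collecting all factors \<open>x\<close> on the left produces the
  geometric sum.\<close>

lemma coset_pow:
  assumes g: "g \<in> carrier G" and k: "\<And>x. x \<in> P \<Longrightarrow> g \<otimes> x = x [^] (k::nat) \<otimes> g" and x: "x \<in> P"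
  shows "(x \<otimes> g) [^] i = x [^] (\<Sum>j<i. k ^ j) \<otimes> g [^] i"
proof (induction i)
  case (Suc i)
  define s where "s = (\<Sum>j<i. k ^ j)"
  have xc: "x \<in> carrier G" using P_closed[OF x] .
  have s: "(\<Sum>j<Suc i. k ^ j) = 1 + s * k"
    unfolding s_def sum.lessThan_Suc_shift by (simp add: sum_distrib_left sum_distrib_right mult.commute)
  have "(x \<otimes> g) [^] Suc i = (x \<otimes> g) \<otimes> (x [^] s \<otimes> g [^] i)"
    using Suc xc g nat_pow_Suc2[of "x \<otimes> g" i] by (simp add: s_def)
  also have "\<dots> = x \<otimes> (g \<otimes> x [^] s) \<otimes> g [^] i" using xc g by (simp add: m_assoc)
  also have "\<dots> = x \<otimes> ((x [^] s) [^] k \<otimes> g) \<otimes> g [^] i" using k[OF pow_mem_P[OF x]] by simp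
  also have "\<dots> = (x [^] (1::nat) \<otimes> x [^] (s * k)) \<otimes> (g \<otimes> g [^] i)"
    using xc g by (simp add: m_assoc nat_pow_pow)
  also have "\<dots> = x [^] (1 + s * k) \<otimes> g [^] Suc i"
    using nat_pow_mult[OF xc, of 1 "s * k"] nat_pow_Suc2[OF g] by simp
  finally show ?case unfolding s .
qed simp

text \<open>A suitable power of any representative kills its \<open>P\<close>-part and stays in the coset.\<close>
lemma coset_representative:
  assumes "C \<in> carrier Q"
  obtains g where "g \<in> carrier G" "C = P #> g" "g [^] Q.ord C = \<one>"
proof -
  obtain h where h: "h \<in> carrier G" "C = P #> h"
    using assms unfolding carrier_FactGroup by blast
  define d where "d = Q.ord C"
  have "coprime (p ^ a) d"
    using coprime_ord_Q[OF assms] unfolding d_def by (simp add: coprime_power_left_iff)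
  moreover have "p ^ a \<noteq> 0" using prime_gt_0_nat[OF prime_p] by simp
  \<comment> \<open>Bezout gives an exponent \<open>p ^ a * u\<close> that is 0 modulo
    \<open>p ^ a\<close> and 1 modulo \<open>d\<close>, so raising to it fixes \<open>C\<close> and
    kills elements of \<open>P\<close>.\<close>
  ultimately obtain D u v where "D dvd p ^ a" "D dvd d" and uv: "p ^ a * u = d * v + D"
    using bezout_add_strong_nat[of "p ^ a" d] by blast
  then have "D = 1" using \<open>coprime (p ^ a) d\<close> coprime_common_divisor_nat by blast
  define g where "g = h [^] (p ^ a * u)"
  have g: "g \<in> carrier G" using h by (simp add: g_def)
  have "P #> g = C [^]\<^bsub>Q\<^esub> (d * v + 1)"
    unfolding g_def uv h(2) \<open>D = 1\<close> FactGroup_pow[OF h(1)] ..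
  also have "\<dots> = C"
  proof -
    have "C [^]\<^bsub>Q\<^esub> (d * v) = \<one>\<^bsub>Q\<^esub>"
      using Q.pow_eq_id[OF assms, of "d * v"] by (simp add: d_def)
    then show ?thesis using Q.nat_pow_Suc[of C "d * v"] Q.l_one[OF assms] by simp
  qed
  finally have "P #> g = C" .
  moreover have "g [^] d = \<one>"
  proof -
    have "P #> (h [^] d) = \<one>\<^bsub>Q\<^esub>"
      using FactGroup_pow[OF h(1), of d] h(2) Q.pow_ord_eq_1[OF assms] by (simp add: d_def)
    then have "h [^] d \<in> P" using coset_join1[OF _ nat_pow_closed[OF h(1)] subgroup_P] by simp
    then have "(h [^] d) [^] (p ^ a) = \<one>" by (rule P_pow_eq_one)
    then have "((h [^] d) [^] (p ^ a)) [^] u = \<one>" by simp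
    then show ?thesis using h(1) by (simp add: g_def nat_pow_pow mult_ac)
  qed
  ultimately show thesis using that g d_def by blast
qed

section \<open>Element orders within a coset\<close>

lemma ord_pos: "x \<in> carrier G \<Longrightarrow> ord x > 0"
  using ord_ge_1[OF finite_carrier] by fastforce

lemma sum_coset:
  assumes "g \<in> carrier G"
  shows "(\<Sum>y \<in> P #> g. f y) = (\<Sum>x \<in> P. f (x \<otimes> g))"
proof -
  have "P #> g = (\<lambda>x. x \<otimes> g) ` P" by (auto simp: r_coset_def)
  moreover have "inj_on (\<lambda>x. x \<otimes> g) P"
    using assms P_closed by (auto intro!: inj_onI)
  ultimately show ?thesis by (simp add: sum.reindex)
qed

text \<open>For a representative \<open>g\<close> with \<open>g [^] d = \<one>\<close>, the element
  \<open>(x \<otimes> g) [^] d\<close> is a power of \<open>x\<close>, so the order of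
  \<open>x \<otimes> g\<close> divides \<open>d * ord x\<close>.\<close>

lemma sum_ord_coset_le:
  assumes C: "C \<in> carrier Q"
  shows "(\<Sum>y \<in> C. ord y) \<le> Q.ord C * cyclic_psi (p ^ a)"
proof -
  define d where "d = Q.ord C"
  obtain g where g: "g \<in> carrier G" "C = P #> g" "g [^] d = \<one>"
    using coset_representative[OF C] unfolding d_def by blast
  obtain k :: nat where k: "\<And>x. x \<in> P \<Longrightarrow> g \<otimes> x = x [^] k \<otimes> g"
    using conj_pow[OF g(1)] by blast
  have "ord (x \<otimes> g) \<le> d * ord x" if x: "x \<in> P" for x
  proof -
    have xc: "x \<in> carrier G" using P_closed[OF x] .
    define s where "s = (\<Sum>j<d. k ^ j)"
    have "(x \<otimes> g) [^] d = x [^] s"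
      using coset_pow[OF g(1) k x, of d] g(3) xc by (simp add: s_def)
    then have "(x \<otimes> g) [^] (d * ord x) = x [^] (ord x * s)"
      using xc g(1) nat_pow_pow[of "x \<otimes> g" d "ord x"] nat_pow_pow[OF xc, of s "ord x"]
      by (simp add: mult.commute)
    then have "(x \<otimes> g) [^] (d * ord x) = \<one>"
      using xc pow_eq_id[OF xc, of "ord x * s"] by simp
    then have "ord (x \<otimes> g) dvd d * ord x" using xc g(1) pow_eq_id by simp
    then show ?thesis
      using Q_ord_pos[OF C] ord_pos[OF xc] by (intro dvd_imp_le) (simp_all add: d_def)
  qed
  then have "(\<Sum>x \<in> P. ord (x \<otimes> g)) \<le> (\<Sum>x \<in> P. d * ord x)" by (rule sum_mono)
  also have "\<dots> = d * cyclic_psi (p ^ a)"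
    using sum_ord_generate[OF c_closed ord_c_pos] ord_c by (simp add: sum_distrib_left[symmetric])
  finally show ?thesis using sum_coset[OF g(1), of ord] g(2) by (simp add: d_def)
qed

text \<open>If a representative \<open>g\<close> of order \<open>d\<close> acts on \<open>P\<close> by \<open>x \<mapsto> x\<^sup>k\<close>, then \<open>(x g)\<^sup>d = x\<^sup>s\<close> with
  \<open>s = 1 + k + \<dots> + k\<^sup>d\<^sup>-\<^sup>1\<close> and \<open>(k - 1) s \<equiv> 0\<close> modulo \<open>p\<^sup>a\<close>. Either \<open>p\<close> divides \<open>k - 1\<close>, so that
  \<open>s \<equiv> d\<close> is a unit modulo \<open>p\<close> and \<open>g\<close> acts trivially, or \<open>p\<^sup>a\<close> divides \<open>s\<close>.\<close>
lemma sum_ord_coset_le_or_commutes: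
  assumes C: "C \<in> carrier Q"
  shows "(\<Sum>y \<in> C. ord y) \<le> Q.ord C * p ^ a \<or> (\<forall>y \<in> C. y \<otimes> c = c \<otimes> y)"
proof -
  define d where "d = Q.ord C"
  obtain g where g: "g \<in> carrier G" "C = P #> g" "g [^] d = \<one>"
    using coset_representative[OF C] unfolding d_def by blast
  obtain k :: nat where k: "\<And>x. x \<in> P \<Longrightarrow> g \<otimes> x = x [^] k \<otimes> g"
    using conj_pow[OF g(1)] by blast
  define s where "s = (\<Sum>j<d. k ^ j)"
  have power_eq: "c [^] i = c [^] j \<longleftrightarrow> int p ^ a dvd int i - int j" for i j :: nat
    using int_pow_eq[OF c_closed, of "int j" "int i"] ord_c
    by (auto simp: int_pow_int)
  have "g [^] i \<otimes> c = c [^] (k ^ i) \<otimes> g [^] i" for i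
  proof (induction i)
    case (Suc i)
    have "g [^] Suc i \<otimes> c = g \<otimes> (g [^] i \<otimes> c)"
      using g(1) c_closed nat_pow_Suc2[OF g(1)] by (simp add: m_assoc)
    also have "\<dots> = g \<otimes> c [^] (k ^ i) \<otimes> g [^] i"
      using Suc g(1) c_closed by (simp add: m_assoc)
    also have "\<dots> = (c [^] (k ^ i)) [^] k \<otimes> g \<otimes> g [^] i"
      using k[OF pow_mem_P[OF c_mem]] by simp
    also have "\<dots> = c [^] (k ^ Suc i) \<otimes> g [^] Suc i"
      using g(1) c_closed nat_pow_Suc2[OF g(1)] by (simp add: m_assoc nat_pow_pow mult.commute)
    finally show ?case .
  qed (use c_closed in simp)
  \<comment> \<open>Conjugating \<open>d\<close> times by \<open>g\<close> is trivial, hence k^d is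
    1 modulo \<open>p ^ a\<close>.\<close>
  from this[of d] have "c [^] (k ^ d) = c [^] (1::nat)" using g(3) c_closed by simp
  then have "int p ^ a dvd int k ^ d - 1" unfolding power_eq by simp
  moreover have "int k ^ d - 1 = (int k - 1) * int s"
    unfolding s_def using power_diff_1_eq[of "int k" d] by simp
  ultimately have dvd: "int p ^ a dvd (int k - 1) * int s" by simp
  have "prime_elem (int p)" using prime_p by simp
  show ?thesis
  proof (cases "int p dvd int k - 1")
    case True
    then have "[int k = 1] (mod int p)" by (simp add: cong_iff_dvd_diff)
    then have "[(\<Sum>j<d. int k ^ j) = (\<Sum>j<d. 1 ^ j)] (mod int p)"
      by (intro cong_sum cong_pow)
    then have "[int s = int d] (mod int p)" by (simp add: s_def)
    moreover have "coprime (int d) (int p)"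
      using coprime_ord_Q[OF C] by (simp add: d_def coprime_commute)
    ultimately have "coprime (int p ^ a) (int s)"
      by (metis cong_imp_coprime cong_sym coprime_commute coprime_power_left_iff)
    then have "int p ^ a dvd int k - 1" using dvd coprime_dvd_mult_left_iff by blast
    then have "c [^] k = c [^] (1::nat)" unfolding power_eq by simp
    then have gc: "g \<otimes> c = c \<otimes> g" using k[OF c_mem] c_closed by simp
    have "y \<otimes> c = c \<otimes> y" if y_mem: "y \<in> C" for y
    proof -
      obtain i :: nat where y: "y = c [^] i \<otimes> g"
        using y_mem unfolding g(2) r_coset_def by (auto simp: mem_P_iff)
      have "y \<otimes> c = (c [^] i \<otimes> c) \<otimes> g" unfolding y using g(1) c_closed gc by (simp add: m_assoc)
      also have "c [^] i \<otimes> c = c \<otimes> c [^] i" using nat_pow_Suc2[OF c_closed] by simp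
      finally show ?thesis unfolding y using g(1) c_closed by (simp add: m_assoc)
    qed
    then show ?thesis by blast
  next
    case False
    then have "coprime (int p ^ a) (int k - 1)"
      using \<open>prime_elem (int p)\<close> prime_elem_imp_coprime coprime_power_left_iff by metis
    then have "int p ^ a dvd int s" using dvd coprime_dvd_mult_right_iff by blast
    then have s: "p ^ a dvd s" by (metis of_nat_dvd_iff of_nat_power)
    have "ord (x \<otimes> g) \<le> d" if x: "x \<in> P" for x
    proof -
      have xc: "x \<in> carrier G" using P_closed[OF x] .
      have "ord x dvd s" using P_pow_eq_one[OF x] pow_eq_id[OF xc] s dvd_trans by blast
      then have "x [^] s = \<one>" using pow_eq_id[OF xc] by simp
      then have "(x \<otimes> g) [^] d = \<one>"
        using coset_pow[OF g(1) k x, of d] g(3) by (simp add: s_def)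
      then have "ord (x \<otimes> g) dvd d" using xc g(1) pow_eq_id by simp
      then show ?thesis using Q_ord_pos[OF C] by (simp add: d_def dvd_imp_le)
    qed
    then have "(\<Sum>x \<in> P. ord (x \<otimes> g)) \<le> (\<Sum>x \<in> P. d)" by (rule sum_mono)
    then show ?thesis using sum_coset[OF g(1), of ord] g(2) card_P by (simp add: d_def mult.commute)
  qed
qed

lemma psi_eq_sum_cosets: "psi G = (\<Sum>C \<in> carrier Q. \<Sum>y \<in> C. ord y)"
proof -
  have "psi G = (\<Sum>y \<in> \<Union>(carrier Q). ord y)"
    unfolding psi_def carrier_Q rcosets_part_G[OF subgroup_P] ..
  also have "\<dots> = (\<Sum>C \<in> carrier Q. \<Sum>y \<in> C. ord y)"
    using cosets_finite[OF _ subset finite_carrier] rcos_disjoint[OF subgroup_P]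
    unfolding carrier_Q by (subst sum.Union_disjoint) (auto simp: pairwise_def disjnt_def)
  finally show ?thesis .
qed

lemma psi_le_psi_Q: "psi G \<le> psi Q * cyclic_psi (p ^ a)"
  unfolding psi_eq_sum_cosets psi_def[of Q] sum_distrib_right
  by (rule sum_mono) (rule sum_ord_coset_le)

section \<open>The centraliser of P and the case of a cyclic quotient\<close>

text \<open>Since \<open>c\<close> generates \<open>P\<close>, this is the centraliser of
  \<open>P\<close>.\<close>

definition cent where "cent = {y \<in> carrier G. y \<otimes> c = c \<otimes> y}"

lemma subgroup_cent: "subgroup cent G"
proof (rule subgroupI)
  fix x y assume x: "x \<in> cent" and y: "y \<in> cent"
  have xc: "x \<in> carrier G" "x \<otimes> c = c \<otimes> x" and yc: "y \<in> carrier G" "y \<otimes> c = c \<otimes> y"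
    using x y by (auto simp: cent_def)
  have "x \<otimes> y \<otimes> c = x \<otimes> c \<otimes> y" using xc(1) yc c_closed by (simp add: m_assoc)
  then show "x \<otimes> y \<in> cent" using xc yc c_closed by (simp add: cent_def m_assoc)
  have "inv x \<otimes> c = inv x \<otimes> (c \<otimes> x) \<otimes> inv x" using xc(1) c_closed by (simp add: m_assoc)
  also have "\<dots> = inv x \<otimes> (x \<otimes> c) \<otimes> inv x" using xc(2) by simp
  also have "\<dots> = c \<otimes> inv x" using xc(1) c_closed by (simp flip: m_assoc)
  finally show "inv x \<in> cent" using xc(1) by (simp add: cent_def)
qed (use c_closed in \<open>auto simp: cent_def\<close>)

text \<open>A coset meeting \<open>cent\<close> has order dividing both \<open>card cent\<close> and
  \<open>order Q\<close>, hence their gcd \<open>e\<close>. If \<open>e\<close> were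
  \<open>order Q\<close>, then \<open>card cent\<close> would be divisible by \<open>order Q\<close>
  and by \<open>p ^ a\<close>, forcing \<open>cent\<close> to be everything; so some prime
  \<open>r\<close> divides the cofactor of \<open>e\<close>.\<close>

lemma coset_pow_eq_one_if_commutes:
  assumes "cent \<noteq> carrier G"
  obtains r where "Factorial_Ring.prime r" "r dvd order Q"
    "\<And>C y. C \<in> carrier Q \<Longrightarrow> y \<in> C \<Longrightarrow> y \<otimes> c = c \<otimes> y \<Longrightarrow> C [^]\<^bsub>Q\<^esub> (order Q div r) = \<one>\<^bsub>Q\<^esub>"
proof -
  define m where "m = order Q"
  define e where "e = gcd (card cent) m"
  have Kc: "cent \<subseteq> carrier G" by (auto simp: cent_def)
  have m0: "m > 0" unfolding m_def using Q.order_gt_0_iff_finite finite_Q by blast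
  have "e \<noteq> m"
  proof
    assume "e = m"
    then have "m dvd card cent" unfolding e_def by (metis gcd_dvd1)
    moreover have "c \<in> cent" using c_closed by (simp add: cent_def)
    then have "p ^ a dvd card cent"
      using pow_card_subgroup_eq_one[OF subgroup_cent] pow_eq_id[OF c_closed] ord_c by metis
    moreover have "coprime m (p ^ a)"
      using coprime_index by (simp add: m_def coprime_commute coprime_power_right_iff)
    ultimately have "order G dvd card cent" unfolding order_Q m_def[symmetric] by (rule divides_mult)
    moreover have "finite cent" using Kc finite_carrier finite_subset by blast
    moreover have "card cent > 0" using \<open>c \<in> cent\<close> \<open>finite cent\<close> card_gt_0_iff by blast
    ultimately have "card (carrier G) \<le> card cent" by (simp add: dvd_imp_le order_def)
    then have "cent = carrier G" using card_seteq[OF finite_carrier Kc] by simp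
    then show False using assms by simp
  qed
  have e: "e dvd m" by (simp add: e_def)
  then obtain t where t: "m = e * t" by blast
  then have "t \<noteq> 1" using \<open>e \<noteq> m\<close> by auto
  then obtain r where r: "Factorial_Ring.prime r" "r dvd t" using prime_factor_nat by blast
  then obtain w where w: "t = r * w" by blast
  have "m div r = e * w" using t w prime_gt_0_nat[OF r(1)] by simp
  then have "e dvd m div r" by simp
  have "C [^]\<^bsub>Q\<^esub> (m div r) = \<one>\<^bsub>Q\<^esub>" if C: "C \<in> carrier Q" and y: "y \<in> C" "y \<otimes> c = c \<otimes> y" for C y
  proof -
    have yc: "y \<in> carrier G"
      using C y(1) rcosets_part_G[OF subgroup_P] unfolding carrier_Q by blast
    have Cy: "C = P #> y"
      using C y(1) repr_independence[OF _ _ subgroup_P] unfolding carrier_FactGroup by blast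
    have "y [^] card cent = \<one>"
      using pow_card_subgroup_eq_one[OF subgroup_cent] yc y(2) by (simp add: cent_def)
    then have "C [^]\<^bsub>Q\<^esub> card cent = \<one>\<^bsub>Q\<^esub>"
      using FactGroup_pow[OF yc] Cy subset by simp
    then have "Q.ord C dvd card cent" using Q.pow_eq_id[OF C] by simp
    moreover have "Q.ord C dvd m" unfolding m_def by (rule Q.ord_dvd_group_order[OF C])
    ultimately have "Q.ord C dvd m div r"
      using \<open>e dvd m div r\<close> unfolding e_def by (meson dvd_trans gcd_greatest)
    then show ?thesis using Q.pow_eq_id[OF C] by simp
  qed
  moreover have "r dvd m" using t w by simp
  ultimately show thesis using that r(1) unfolding m_def by blast
qed

text \<open>A generator of \<open>Q\<close> lifts to some \<open>g\<close> of order coprime to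
  \<open>p\<close>; as \<open>g\<close> commutes with \<open>c\<close>, the product
  \<open>c \<otimes> g\<close> has order \<open>order Q * p ^ a\<close>.\<close>

lemma cyclic_if_central:
  assumes "cyclic_group Q" "cent = carrier G"
  shows "cyclic_group G"
proof -
  obtain C where C: "C \<in> carrier Q" "Q.ord C = order Q"
    using assms(1) Q.cyclic_group_iff_ord_eq_order[OF finite_Q] by blast
  obtain g where g: "g \<in> carrier G" "C = P #> g" "g [^] order Q = \<one>"
    using coset_representative[OF C(1)] C(2) by metis
  have gc: "c \<otimes> g = g \<otimes> c" using assms(2) g(1) unfolding cent_def by (metis (lifting) mem_Collect_eq)
  define N where "N = ord (c \<otimes> g)"
  have cg: "c \<otimes> g \<in> carrier G" using c_closed g(1) by simp
  have "P #> (c \<otimes> g) = C"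
    using repr_independence[OF _ g(1) subgroup_P, of "c \<otimes> g"] c_mem g(2) by (auto simp: r_coset_def)
  then have "C [^]\<^bsub>Q\<^esub> N = \<one>\<^bsub>Q\<^esub>"
    using FactGroup_pow[OF cg, of N] pow_ord_eq_1[OF cg] subset by (simp add: N_def)
  then have mN: "order Q dvd N" using Q.pow_eq_id[OF C(1)] C(2) by simp
  then have "g [^] N = \<one>" using g(1,3) pow_eq_id dvd_trans by blast
  moreover have "c [^] N \<otimes> g [^] N = \<one>"
    using pow_mult_distrib[OF gc c_closed g(1), of N] pow_ord_eq_1[OF cg] by (simp add: N_def)
  ultimately have "c [^] N = \<one>" using c_closed by simp
  then have "p ^ a dvd N" using pow_eq_id[OF c_closed] ord_c by simp
  then have "order G dvd N"
    unfolding order_Q using mN coprime_index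
    by (intro divides_mult) (simp_all add: coprime_commute coprime_power_right_iff)
  then have "N = order G"
    using ord_dvd_group_order[OF cg] dvd_antisym unfolding N_def by blast
  then show ?thesis
    using cyclic_group_iff_ord_eq_order[OF finite_carrier] cg unfolding N_def by blast
qed

text \<open>Cosets killed by \<open>order Q div r\<close> receive the general bound, all others the
  bound for cosets that do not centralise \<open>P\<close>. The orders of the former sum to
  \<open>cyclic_psi (order Q div r)\<close>; the subtracted term is moved to the left side.\<close>

lemma psi_le_if_cyclic_Q:
  assumes "cyclic_group Q" "\<not> cyclic_group G"
  obtains r where "Factorial_Ring.prime r" "r dvd order Q"
    "psi G + cyclic_psi (order Q div r) * p ^ a
      \<le> cyclic_psi (order Q) * p ^ a + cyclic_psi (order Q div r) * cyclic_psi (p ^ a)"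
proof -
  have div_dvd_self: "order Q div r dvd order Q" if "r dvd order Q" for r
    using that by (metis dvd_div_mult_self dvd_triv_left)
  have "cent \<noteq> carrier G" using cyclic_if_central assms by blast
  then obtain r where r: "Factorial_Ring.prime r" "r dvd order Q"
    and comm: "\<And>C y. C \<in> carrier Q \<Longrightarrow> y \<in> C \<Longrightarrow> y \<otimes> c = c \<otimes> y
      \<Longrightarrow> C [^]\<^bsub>Q\<^esub> (order Q div r) = \<one>\<^bsub>Q\<^esub>"
    using coset_pow_eq_one_if_commutes by blast
  define S where "S = {C \<in> carrier Q. C [^]\<^bsub>Q\<^esub> (order Q div r) = \<one>\<^bsub>Q\<^esub>}"
  obtain C0 where C0: "C0 \<in> carrier Q" "Q.ord C0 = order Q"
    using assms(1) Q.cyclic_group_iff_ord_eq_order[OF finite_Q] by blast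
  have sumS: "(\<Sum>C \<in> S. Q.ord C) = cyclic_psi (order Q div r)"
    using Q.sum_ord_cyclic[OF C0(1) Q_ord_pos[OF C0(1)], of "order Q div r"] C0(2) r(2)
      Q.generate_eq_carrier_if_ord_eq_order[OF finite_Q C0]
    by (simp add: S_def div_dvd_self)
  have sumQ: "(\<Sum>C \<in> carrier Q. Q.ord C) = cyclic_psi (order Q)"
    using Q.psi_eq_cyclic_psi[OF finite_Q C0] by (simp add: psi_def)
  have SQ: "S \<subseteq> carrier Q" by (auto simp: S_def)
  have split: "(\<Sum>C \<in> carrier Q. f C) = (\<Sum>C \<in> S. f C) + (\<Sum>C \<in> carrier Q - S. f C)" for f :: "'a set \<Rightarrow> nat"
    using sum.subset_diff[OF SQ finite_Q, of f] by (simp add: add.commute)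
  have "(\<Sum>C \<in> S. \<Sum>y \<in> C. ord y) \<le> (\<Sum>C \<in> S. Q.ord C * cyclic_psi (p ^ a))"
    using SQ by (intro sum_mono sum_ord_coset_le) auto
  moreover have "(\<Sum>C \<in> carrier Q - S. \<Sum>y \<in> C. ord y) \<le> (\<Sum>C \<in> carrier Q - S. Q.ord C * p ^ a)"
  proof (rule sum_mono)
    fix C assume C: "C \<in> carrier Q - S"
    obtain h where h: "h \<in> carrier G" "C = P #> h"
      using C unfolding carrier_FactGroup by blast
    have "h \<in> C" using rcos_self[OF h(1) subgroup_P] h(2) by simp
    \<comment> \<open>No element of a coset outside \<open>S\<close> commutes with \<open>c\<close>,
      and a single such element excludes the commuting alternative.\<close>
    then have "h \<otimes> c \<noteq> c \<otimes> h" using comm[of C h] C by (auto simp: S_def)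
    then show "(\<Sum>y \<in> C. ord y) \<le> Q.ord C * p ^ a"
      using sum_ord_coset_le_or_commutes[of C] C \<open>h \<in> C\<close> by blast
  qed
  ultimately have "psi G \<le> (\<Sum>C \<in> S. Q.ord C) * cyclic_psi (p ^ a) + (\<Sum>C \<in> carrier Q - S. Q.ord C) * p ^ a"
    unfolding psi_eq_sum_cosets split[of "\<lambda>C. \<Sum>y \<in> C. ord y"] sum_distrib_right by linarith
  moreover have "cyclic_psi (order Q) = cyclic_psi (order Q div r) + (\<Sum>C \<in> carrier Q - S. Q.ord C)"
    using split[of Q.ord] sumS sumQ by simp
  ultimately have "psi G + cyclic_psi (order Q div r) * p ^ a
      \<le> cyclic_psi (order Q) * p ^ a + cyclic_psi (order Q div r) * cyclic_psi (p ^ a)"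
    unfolding sumS by (simp add: algebra_simps)
  then show thesis using that r by blast
qed

end

section \<open>Cyclic subgroups of small index\<close>

lemma (in group) pow_mem_subgroup_coprime:
  assumes H: "subgroup H G" and y: "y \<in> carrier G" and yi: "y [^] i \<in> H" and yj: "y [^] j \<in> H"
    and cop: "coprime i (j::nat)" and "i \<noteq> 0"
  shows "y \<in> H"
proof -
  obtain D u v where "D dvd i" "D dvd j" and uv: "i * u = j * v + D"
    using bezout_add_strong_nat[OF \<open>i \<noteq> 0\<close>, of j] by blast
  then have "D = 1" using cop coprime_common_divisor_nat by blast
  have pow_mem: "z [^] k \<in> H" if "z \<in> H" for z and k :: nat
    using subgroup_int_pow_closed[OF H that, of "int k"] by (simp add: int_pow_int)
  have "y [^] (j * v) \<otimes> y = y [^] (i * u)" using uv \<open>D = 1\<close> by simp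
  then have "y = inv (y [^] (j * v)) \<otimes> y [^] (i * u)"
    using y by (metis inv_solve_left nat_pow_closed)
  moreover have "y [^] (j * v) \<in> H" "y [^] (i * u) \<in> H"
    using pow_mem[OF yj, of v] pow_mem[OF yi, of u] y by (simp_all add: nat_pow_pow)
  ultimately show ?thesis
    using subgroup.m_closed[OF H] subgroup.m_inv_closed[OF H] by metis
qed

text \<open>Among the cosets \<open>H y\<^sup>i\<close> with \<open>i < p\<close> two coincide.\<close>
lemma (in group) mem_subgroup_if_index_less:
  assumes fin: "finite (carrier G)" and H: "subgroup H G" and p: "Factorial_Ring.prime p"
    and index: "card (rcosets H) < p" and y: "y \<in> carrier G" "y [^] (p ^ a) = \<one>"
  shows "y \<in> H"
proof -
  have "(\<lambda>i. H #> y [^] i) ` {..<p} \<subseteq> rcosets H"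
    using y(1) unfolding RCOSETS_def by blast
  moreover have "finite (rcosets H)"
    using fin unfolding RCOSETS_def by simp
  ultimately have "card ((\<lambda>i. H #> y [^] i) ` {..<p}) < card {..<p}"
    using index card_mono by (metis card_lessThan le_less_trans)
  then have "\<not> inj_on (\<lambda>i. H #> y [^] i) {..<p}" by (rule pigeonhole)
  then obtain i j :: nat where ij: "i < j" "j < p" "H #> y [^] i = H #> y [^] j"
    unfolding inj_on_def by (metis lessThan_iff linorder_neqE_nat)
  have "y [^] j \<in> H #> y [^] i"
    using rcos_self[OF nat_pow_closed[OF y(1)] H] ij(3) by metis
  then obtain h where h: "h \<in> H" "y [^] j = h \<otimes> y [^] i" unfolding r_coset_def by blast
  have "y [^] (j - i) \<otimes> y [^] i = h \<otimes> y [^] i"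
    using h(2) ij(1) y(1) by (simp add: nat_pow_mult)
  moreover have "h \<in> carrier G" using subgroup.mem_carrier[OF H h(1)] .
  ultimately have "y [^] (j - i) \<in> H" using h(1) y(1) r_cancel by simp
  moreover have "y [^] (p ^ a) \<in> H" using y(2) subgroup.one_closed[OF H] by simp
  \<comment> \<open>As 0 < j - i < p, the exponents \<open>j - i\<close> and \<open>p ^ a\<close>
    are coprime, and both of these powers of \<open>y\<close> lie in \<open>H\<close>.\<close>
  moreover have "\<not> p dvd j - i" using ij by (auto dest: dvd_imp_le)
  then have "coprime (j - i) (p ^ a)"
    using p by (simp add: prime_imp_coprime coprime_commute coprime_power_right_iff)
  ultimately show ?thesis using pow_mem_subgroup_coprime[OF H y(1)] ij(1) by simp
qed

text \<open>The index of the subgroup generated by \<open>x\<close> is below \<open>p\<close>, so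
  \<open>p ^ a\<close> divides \<open>ord x\<close> and a power \<open>c\<close> of \<open>x\<close>
  has order \<open>p ^ a\<close>. Every element killed by \<open>p ^ a\<close> lies in that
  subgroup, so these elements are exactly the powers of \<open>c\<close>, a set closed under
  conjugation.\<close>

lemma (in group) normal_cyclic_hall_if_index_less:
  assumes fin: "finite (carrier G)" and p: "Factorial_Ring.prime p"
    and x: "x \<in> carrier G" and index: "order G < p * ord x"
    and order: "order G = m * p ^ a" "\<not> p dvd m"
  obtains c where "normal_cyclic_hall G c p a"
proof -
  define H where "H = generate G {x}"
  have p0: "p > 0" using prime_gt_0_nat[OF p] .
  have x0: "ord x > 0" using ord_ge_1[OF fin x] by simp
  have H: "subgroup H G" unfolding H_def using x by (intro generate_is_subgroup) simp
  have lag: "card (rcosets H) * ord x = order G"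
    using lagrange[OF H] generate_pow_card[OF x] by (simp add: H_def)
  then have less: "card (rcosets H) < p" using index by (metis mult_less_cancel2)
  have n0: "order G > 0" using fin order_gt_0_iff_finite by blast
  then have "\<not> p dvd card (rcosets H)" using less lag by (auto dest: dvd_imp_le)
  then have "coprime (p ^ a) (card (rcosets H))"
    using p by (simp add: prime_imp_coprime coprime_power_left_iff)
  moreover have "p ^ a dvd card (rcosets H) * ord x" using lag order(1) by simp
  ultimately have "p ^ a dvd ord x" using coprime_dvd_mult_right_iff by blast
  then obtain w where w: "ord x = p ^ a * w" by blast
  define c where "c = x [^] w"
  have c: "c \<in> carrier G" using x by (simp add: c_def)
  have "w \<noteq> 0" using w x0 by (metis mult_0_right less_irrefl)
  then have ord_c: "ord c = p ^ a"
    using ord_pow[OF x, of w] w by (simp add: c_def)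
  have ord_c0: "ord c > 0" using ord_c p0 by simp
  have mem: "y \<in> generate G {c} \<longleftrightarrow> y \<in> carrier G \<and> y [^] (p ^ a) = \<one>" for y
  proof
    assume "y \<in> generate G {c}"
    then obtain i :: nat where i: "y = c [^] i" using mem_generate_iff_nat_pow[OF c ord_c0] by blast
    have "y [^] (p ^ a) = c [^] (i * p ^ a)" using i c by (simp add: nat_pow_pow)
    then show "y \<in> carrier G \<and> y [^] (p ^ a) = \<one>"
      using i c pow_eq_id[OF c] ord_c by simp
  next
    assume y: "y \<in> carrier G \<and> y [^] (p ^ a) = \<one>"
    then have "y \<in> H" using mem_subgroup_if_index_less[OF fin H p less] by blast
    then obtain l :: nat where l: "y = x [^] l"
      using mem_generate_iff_nat_pow[OF x x0] unfolding H_def by blast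
    have "x [^] (l * p ^ a) = \<one>" using y l x by (simp add: nat_pow_pow)
    then have "p ^ a * w dvd p ^ a * l" using pow_eq_id[OF x] w by (simp add: mult.commute)
    then have "w dvd l" using p0 by simp
    then obtain j where "l = w * j" by blast
    then have "y = c [^] j" using l x by (simp add: c_def nat_pow_pow)
    then show "y \<in> generate G {c}" using mem_generate_iff_nat_pow[OF c ord_c0] by blast
  qed
  have sub: "subgroup (generate G {c}) G" using c by (intro generate_is_subgroup) simp
  have normal: "generate G {c} \<lhd> G"
  proof (rule normal_invI[OF sub])
    fix g h assume g: "g \<in> carrier G" and "h \<in> generate G {c}"
    then have h: "h \<in> carrier G" "h [^] (p ^ a) = \<one>" using mem by auto
    have "(g \<otimes> h \<otimes> inv g) [^] i = g \<otimes> h [^] i \<otimes> inv g" for i :: nat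
    proof (induction i)
      case (Suc i)
      have "inv g \<otimes> (g \<otimes> z) = z" if "z \<in> carrier G" for z
        using g that by (simp flip: m_assoc)
      then show ?case using Suc g h(1) by (simp add: m_assoc)
    qed (use g in simp)
    then show "g \<otimes> h \<otimes> inv g \<in> generate G {c}" using mem g h by simp
  qed
  have "order (G Mod generate G {c}) * p ^ a = m * p ^ a"
    using lagrange[OF sub] generate_pow_card[OF c] ord_c order(1)
    by (simp add: order_def FactGroup_def)
  then have "order (G Mod generate G {c}) = m" using p0 by simp
  then have "coprime p (order (G Mod generate G {c}))"
    using p order(2) by (simp add: prime_imp_coprime)
  then have "normal_cyclic_hall G c p a"
    using fin c p ord_c normal
    by (intro normal_cyclic_hall.intro normal_cyclic_hall_axioms.intro is_group)
  then show thesis by (rule that)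
qed

section \<open>The strict inequality for a cyclic quotient\<close>

text \<open>Here \<open>Y\<close> stands for psi of the group, \<open>A\<close> for
  \<open>p ^ a\<close>, \<open>B\<close> for \<open>cyclic_psi (p ^ a)\<close>, and
  \<open>M\<close>, \<open>Z\<close> for \<open>cyclic_psi\<close> of m and m/r, with m the order of
  the quotient. One has Z/M \<le> 1/E and A/B \<le> (r + 1)/D, whence Y/(M B) \<le> ((r + 1) E +
  r^2)/(D E).\<close>

lemma cyclic_quotient_estimate:
  fixes Y A B M Z p r :: real
  assumes pos: "0 < A" "0 < B" "0 < M" and r: "1 \<le> r" "r + 1 \<le> p"
    and Y: "Y + Z * A \<le> M * A + Z * B"
    and Z: "(r ^ 2 + 1) * Z \<le> M + r * Z"
    and A: "A * (p ^ 2 - p + 1) \<le> p * B"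
  shows "(r - 1) * Y < M * B"
proof -
  define D where "D = r ^ 2 + r + 1"
  define E where "E = r ^ 2 - r + 1"
  have "r * 1 \<le> r * r" using r(1) by (intro mult_left_mono) auto
  then have E: "E > 0" unfolding E_def power2_eq_square by simp
  have D: "D > 0" unfolding D_def using r by (simp add: add_nonneg_pos)
  have EZ: "E * Z \<le> M" using Z by (simp add: E_def algebra_simps)
  have "1 * 1 \<le> (r + 1) * p" using r by (intro mult_mono) auto
  \<comment> \<open>\<open>D\<close> is the value of p^2 - p + 1 at p = r + 1, and this product is
    the difference of the two sides of the next inequality.\<close>
  then have "0 \<le> (p - (r + 1)) * ((r + 1) * p - 1)" using r by (intro mult_nonneg_nonneg) auto
  then have "p * D \<le> (r + 1) * (p ^ 2 - p + 1)"
    unfolding D_def by (simp add: power2_eq_square algebra_simps)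
  then have "A * (p * D) \<le> A * ((r + 1) * (p ^ 2 - p + 1))" using pos by simp
  also have "\<dots> \<le> (r + 1) * (p * B)"
    using mult_left_mono[OF A, of "r + 1"] r by (simp add: mult_ac)
  finally have "p * (D * A) \<le> p * ((r + 1) * B)" by (simp add: mult_ac)
  then have DA: "D * A \<le> (r + 1) * B" using r by simp
  \<comment> \<open>Needed so that the bound on \<open>D * A\<close> may be multiplied by
    \<open>M - Z\<close>.\<close>
  have "Z \<le> M"
  proof (cases "Z \<le> 0")
    case False
    then have "1 * Z \<le> E * Z"
      using \<open>r * 1 \<le> r * r\<close> by (intro mult_right_mono) (auto simp: E_def power2_eq_square)
    then show ?thesis using EZ by simp
  qed (use pos in simp)
  have "D * Y \<le> D * A * (M - Z) + D * Z * B"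
    using mult_left_mono[OF Y, of D] D by (simp add: algebra_simps)
  also have "\<dots> \<le> (r + 1) * B * (M - Z) + D * Z * B"
    using DA \<open>Z \<le> M\<close> by (simp add: mult_right_mono)
  also have "\<dots> = B * ((r + 1) * M + r ^ 2 * Z)"
    by (simp add: D_def power2_eq_square algebra_simps)
  finally have "E * (D * Y) \<le> E * (B * ((r + 1) * M + r ^ 2 * Z))" using E by simp
  also have "\<dots> = B * ((r + 1) * E * M + r ^ 2 * (E * Z))" by (simp add: algebra_simps)
  also have "\<dots> \<le> B * ((r + 1) * E * M + r ^ 2 * M)"
    using EZ pos by (intro mult_left_mono add_left_mono) auto
  also have "\<dots> = ((r + 1) * E + r ^ 2) * (M * B)" by (simp add: algebra_simps)
  finally have "(r - 1) * (E * (D * Y)) \<le> (r - 1) * (((r + 1) * E + r ^ 2) * (M * B))"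
    using r by (intro mult_left_mono) auto
  also have "\<dots> = ((r - 1) * ((r + 1) * E + r ^ 2)) * (M * B)" by simp
  also have "\<dots> < (E * D) * (M * B)"
  proof (rule mult_strict_right_mono)
    have "E * D - (r - 1) * ((r + 1) * E + r ^ 2) = 2 * r ^ 2 - r + 2"
      by (simp add: E_def D_def power2_eq_square algebra_simps)
    moreover have "2 * r ^ 2 - r + 2 > 0"
      using \<open>r * 1 \<le> r * r\<close> r unfolding power2_eq_square by linarith
    ultimately show "(r - 1) * ((r + 1) * E + r ^ 2) < E * D" by linarith
  qed (use pos in simp)
  finally have "(E * D) * ((r - 1) * Y) < (E * D) * (M * B)" by (simp add: mult_ac)
  then show ?thesis using E D by (simp add: mult_less_cancel_left_pos)
qed

lemma (in normal_cyclic_hall) psi_less_if_cyclic_Q: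
  assumes "cyclic_group Q" "\<not> cyclic_group G" "a > 0"
    and lower: "\<And>r. Factorial_Ring.prime r \<Longrightarrow> r dvd order Q \<Longrightarrow> q \<le> r"
    and upper: "\<And>r. Factorial_Ring.prime r \<Longrightarrow> r dvd order Q \<Longrightarrow> r < p"
  shows "(q - 1) * psi G < cyclic_psi (order Q) * cyclic_psi (p ^ a)"
proof -
  obtain r where r: "Factorial_Ring.prime r" "r dvd order Q"
    and le: "psi G + cyclic_psi (order Q div r) * p ^ a
      \<le> cyclic_psi (order Q) * p ^ a + cyclic_psi (order Q div r) * cyclic_psi (p ^ a)"
    using psi_le_if_cyclic_Q assms(1,2) by blast
  have Q0: "order Q > 0" using Q.order_gt_0_iff_finite finite_Q by blast
  have p0: "p > 0" using prime_gt_0_nat[OF prime_p] .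
  have r1: "r > 1" using prime_gt_1_nat[OF r(1)] .
  have "(real r - 1) * real (psi G) < real (cyclic_psi (order Q)) * real (cyclic_psi (p ^ a))"
  proof (rule cyclic_quotient_estimate)
    show "0 < real (p ^ a)" using p0 by simp
    show "0 < real (cyclic_psi (p ^ a))" using p0 cyclic_psi_pos by simp
    show "0 < real (cyclic_psi (order Q))" using Q0 cyclic_psi_pos by simp
    show "1 \<le> real r" using r1 by simp
    show "real r + 1 \<le> real p" using upper[OF r] by linarith
    show "real (psi G) + real (cyclic_psi (order Q div r)) * real (p ^ a)
      \<le> real (cyclic_psi (order Q)) * real (p ^ a)
        + real (cyclic_psi (order Q div r)) * real (cyclic_psi (p ^ a))"
      using le by (simp only: of_nat_add[symmetric] of_nat_mult[symmetric] of_nat_le_iff)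
    have "real ((r ^ 2 + 1) * cyclic_psi (order Q div r))
        \<le> real (cyclic_psi (order Q) + r * cyclic_psi (order Q div r))"
      using cyclic_psi_div_prime[OF r Q0] by (simp only: of_nat_le_iff)
    then show "((real r) ^ 2 + 1) * real (cyclic_psi (order Q div r))
        \<le> real (cyclic_psi (order Q)) + real r * real (cyclic_psi (order Q div r))"
      by (simp add: algebra_simps)
    show "real (p ^ a) * ((real p) ^ 2 - real p + 1) \<le> real p * real (cyclic_psi (p ^ a))"
      using prime_power_over_cyclic_psi_le[OF prime_p \<open>a > 0\<close>] .
  qed
  then have "real ((r - 1) * psi G) < real (cyclic_psi (order Q) * cyclic_psi (p ^ a))"
    using r1 by (simp add: of_nat_diff)
  then have "(r - 1) * psi G < cyclic_psi (order Q) * cyclic_psi (p ^ a)"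
    by (simp only: of_nat_less_iff)
  moreover have "(q - 1) * psi G \<le> (r - 1) * psi G"
    using lower[OF r] by (intro mult_right_mono) auto
  ultimately show ?thesis by (rule le_less_trans[rotated])
qed

section \<open>An element of large order, and the induction on the group order\<close>

text \<open>Otherwise \<open>p * psi G\<close> is at most the square of the group order, and the
  lower bound for \<open>cyclic_psi\<close> gives pq \<le> (p + 1)(q - 1), that is p + 1 \<le>
  q.\<close>

lemma (in group) exists_ord_large:
  assumes fin: "finite (carrier G)" and "q \<le> p" "q > 0"
    and primes: "\<And>r. Factorial_Ring.prime r \<Longrightarrow> r dvd order G \<Longrightarrow> q \<le> r \<and> r \<le> p"
    and large: "cyclic_psi (order G) \<le> (q - 1) * psi G"
  shows "\<exists>x \<in> carrier G. order G < p * ord x"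
proof (rule ccontr)
  assume "\<not> (\<exists>x \<in> carrier G. order G < p * ord x)"
  then have "(\<Sum>x \<in> carrier G. p * ord x) \<le> (\<Sum>x \<in> carrier G. order G)"
    by (intro sum_mono) (simp add: not_less)
  then have psi_le: "p * psi G \<le> order G ^ 2"
    by (simp add: psi_def sum_distrib_left[symmetric] power2_eq_square order_def)
  have n0: "order G > 0" using fin order_gt_0_iff_finite by blast
  have "q * order G ^ 2 \<le> (p + 1) * cyclic_psi (order G)"
    using \<open>q \<le> p\<close> n0 primes by (intro cyclic_psi_lower_bound) auto
  also have "\<dots> \<le> (p + 1) * ((q - 1) * psi G)" using large by (intro mult_left_mono) auto
  finally have "p * (q * order G ^ 2) \<le> p * ((p + 1) * ((q - 1) * psi G))"
    by (intro mult_left_mono) auto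
  also have "\<dots> = (p + 1) * (q - 1) * (p * psi G)" by (simp only: mult_ac)
  also have "\<dots> \<le> (p + 1) * (q - 1) * order G ^ 2" using psi_le by (intro mult_left_mono) auto
  finally have "(p * q) * order G ^ 2 \<le> ((p + 1) * (q - 1)) * order G ^ 2" by (simp only: mult_ac)
  then have "p * q \<le> (p + 1) * (q - 1)" using n0 by simp
  moreover have "(p + 1) * (q - 1) + (p + 1) = p * q + q"
    using \<open>q > 0\<close> by (cases q) (simp_all add: algebra_simps)
  ultimately show False using \<open>q \<le> p\<close> by linarith
qed

text \<open>Choosing a representative in each coset turns the quotient into a group on the type of \<open>G\<close>,
  which keeps the induction within one type.\<close>
lemma (in normal) FactGroup_iso_same_type:
  obtains f and R :: "'a monoid" where "group R" "f \<in> iso (G Mod H) R"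
proof -
  define f where "f = (\<lambda>C::'a set. SOME x. x \<in> C)"
  have some: "f C \<in> C" if "C \<in> rcosets H" for C
    using rcosets_non_empty[OF that] unfolding f_def by (simp add: some_in_eq)
  have "inj_on f (carrier (G Mod H))"
  proof (rule inj_onI)
    fix C D assume "C \<in> carrier (G Mod H)" "D \<in> carrier (G Mod H)" "f C = f D"
    then have CD: "C \<in> rcosets H" "D \<in> rcosets H" "f C \<in> C" "f C \<in> D"
      using some[of C] some[of D] by (auto simp: FactGroup_def)
    then show "C = D"
      using rcos_disjoint[OF subgroup_axioms] by (auto simp: pairwise_def disjnt_def)
  qed
  then show thesis
    using that inj_imp_image_group_iso[of f "G Mod H"]
      group.inj_imp_image_group_is_group[OF factorgroup_is_group] by blast
qed

text \<open>The induction hypothesis is an explicit assumption about \<open>'a monoid\<close>, so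
  the step serves both the induction and the passage to arbitrary record extensions. Taking
  \<open>q\<close> only as a lower bound for the primes lets the statement pass to quotients whose
  order \<open>q\<close> may not divide.\<close>

lemma psi_less_step:
  fixes G :: "('a, 'b) monoid_scheme" and q :: nat
  assumes "group G" and fin: "finite (carrier G)" and noncyc: "\<not> cyclic_group G" and "q > 0"
    and lower: "\<And>r. Factorial_Ring.prime r \<Longrightarrow> r dvd order G \<Longrightarrow> q \<le> r"
    and IH: "\<And>R :: 'a monoid. group R \<Longrightarrow> finite (carrier R) \<Longrightarrow> \<not> cyclic_group R \<Longrightarrow>
      order R < order G \<Longrightarrow> order R dvd order G \<Longrightarrow> (q - 1) * psi R < cyclic_psi (order R)"
  shows "(q - 1) * psi G < cyclic_psi (order G)"
proof (rule ccontr)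
  assume "\<not> (q - 1) * psi G < cyclic_psi (order G)"
  then have large: "cyclic_psi (order G) \<le> (q - 1) * psi G" by simp
  interpret group G by fact
  define n where "n = order G"
  have n0: "n > 0" unfolding n_def using fin order_gt_0_iff_finite by blast
  \<comment> \<open>The trivial group is cyclic; hence \<open>n\<close> has a largest prime
    factor.\<close>
  have "n \<noteq> 1"
    using noncyc cyclic_group_iff_ord_eq_order[OF fin] ord_id one_closed unfolding n_def by metis
  then have ne: "prime_factors n \<noteq> {}" using n0 by (simp add: prime_factorization_empty_iff)
  define p where "p = Max (prime_factors n)"
  have "p \<in> prime_factors n" unfolding p_def using ne by (intro Max_in) auto
  then have p: "Factorial_Ring.prime p" "p dvd n" by auto
  have upper: "r \<le> p" if "Factorial_Ring.prime r" "r dvd n" for r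
    unfolding p_def using that n0 by (intro Max_ge) (auto simp: prime_factors_dvd)
  have "q \<le> p" using lower p by (simp add: n_def)
  obtain x where x: "x \<in> carrier G" "order G < p * ord x"
    using exists_ord_large[OF fin \<open>q \<le> p\<close> \<open>q > 0\<close> _ large] lower upper unfolding n_def by blast
  obtain a m where am: "n = m * p ^ a" "\<not> p dvd m"
    using prime_power_canonical[OF p(1) n0] by blast
  have "a > 0" using am p(2) by (cases a) auto
  obtain c where "normal_cyclic_hall G c p a"
    using normal_cyclic_hall_if_index_less[OF fin p(1) x am[unfolded n_def]] .
  then interpret normal_cyclic_hall G c p a .
  have "order Q = m" using order_Q am(1) prime_gt_0_nat[OF p(1)] by (simp add: n_def)
  have psi_n: "cyclic_psi n = cyclic_psi (order Q) * cyclic_psi (p ^ a)"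
    unfolding n_def order_Q using coprime_index order_Q n0 prime_gt_0_nat[OF p(1)]
    by (intro cyclic_psi_mult_coprime)
      (auto simp: n_def coprime_commute coprime_power_right_iff simp del: order_gt_0_iff_finite)
  have "(q - 1) * psi G < cyclic_psi n"
  proof (cases "cyclic_group Q")
    case True
    have "r < p" if "Factorial_Ring.prime r" "r dvd order Q" for r
      using that upper[of r] am \<open>order Q = m\<close> by (metis dvd_mult2 le_neq_implies_less)
    moreover have "q \<le> r" if "Factorial_Ring.prime r" "r dvd order Q" for r
      using that lower[of r] order_Q by simp
    ultimately show ?thesis
      unfolding psi_n using psi_less_if_cyclic_Q[OF True noncyc \<open>a > 0\<close>] by blast
  next
    case False
    \<comment> \<open>The noncyclic quotient is copied onto the element type of \<open>G\<close>,
      where the induction hypothesis applies.\<close>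
    obtain f and R :: "'a monoid" where R: "group R" and f: "f \<in> iso Q R"
      using FactGroup_iso_same_type by blast
    have bij: "bij_betw f (carrier Q) (carrier R)" using f by (simp add: iso_def)
    have order_R: "order R = order Q" unfolding order_def using bij_betw_same_card[OF bij] by simp
    have "1 < p ^ a" using prime_gt_1_nat[OF p(1)] \<open>a > 0\<close> by (rule one_less_power)
    then have less: "order R < order G"
      unfolding order_R order_Q using order_Q n0 by (simp add: n_def)
    have "(q - 1) * psi R < cyclic_psi (order R)"
    proof (rule IH[OF R _ _ less])
      show "finite (carrier R)" using bij finite_Q bij_betw_finite by blast
      show "\<not> cyclic_group R"
        using False isomorphic_group_cyclicity[OF is_isoI[OF f] Q.is_group R] by simp
      show "order R dvd order G" unfolding order_R order_Q by simp
    qed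
    then have "(q - 1) * psi Q < cyclic_psi (order Q)"
      using psi_iso[OF Q.is_group R f] order_R by simp
    then have "(q - 1) * psi Q * cyclic_psi (p ^ a) < cyclic_psi n"
      unfolding psi_n using cyclic_psi_pos[of "p ^ a"] prime_gt_0_nat[OF p(1)] by simp
    moreover have "(q - 1) * psi G \<le> (q - 1) * (psi Q * cyclic_psi (p ^ a))"
      using psi_le_psi_Q by (rule mult_left_mono) simp
    ultimately show ?thesis by (simp only: mult.assoc)
  qed
  then show False using large by (simp add: n_def)
qed

lemma psi_less_cyclic_psi_monoid:
  fixes G :: "'a monoid" and q :: nat
  assumes "group G" "finite (carrier G)" "\<not> cyclic_group G" "q > 0"
    and "\<And>r. Factorial_Ring.prime r \<Longrightarrow> r dvd order G \<Longrightarrow> q \<le> r"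
  shows "(q - 1) * psi G < cyclic_psi (order G)"
  using assms
proof (induction "order G" arbitrary: G rule: less_induct)
  case less
  show ?case
  proof (rule psi_less_step[OF less.prems])
    fix R :: "'a monoid"
    assume R: "group R" "finite (carrier R)" "\<not> cyclic_group R" "order R < order G" "order R dvd order G"
    show "(q - 1) * psi R < cyclic_psi (order R)"
    proof (rule less.hyps[OF R(4,1-3) \<open>q > 0\<close>])
      show "q \<le> r" if "Factorial_Ring.prime r" "r dvd order R" for r
        using that R(5) less.prems(5) dvd_trans by blast
    qed
  qed
qed

theorem theorem3:
  fixes G :: "('a, 'b) monoid_scheme" and q :: nat
  assumes "group G"
    and "finite (carrier G)"
    and "\<not> cyclic_group G"
    and "Factorial_Ring.prime q" and "q dvd order G"
    and "\<forall>p::nat. Factorial_Ring.prime p \<and> p dvd order G \<longrightarrow> q \<le> p"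
  shows "real (psi G) < real (psi (integer_mod_group (order G))) / real (q - 1)"
proof -
  have q: "q > 1" using assms(4) by (rule prime_gt_1_nat)
  have "(q - 1) * psi G < cyclic_psi (order G)"
  \<comment> \<open>One further step, fed with the result for \<open>'a monoid\<close>, reaches the
    record type of \<open>G\<close>.\<close>
  proof (rule psi_less_step[OF assms(1-3)])
    fix R :: "'a monoid"
    assume R: "group R" "finite (carrier R)" "\<not> cyclic_group R" "order R dvd order G"
    then show "(q - 1) * psi R < cyclic_psi (order R)"
      using q assms(6) dvd_trans by (intro psi_less_cyclic_psi_monoid) auto
  qed (use q assms(6) in auto)
  moreover have "order G > 0"
    using group.is_monoid[OF assms(1)] assms(2) monoid.order_gt_0_iff_finite by blast
  ultimately have "(q - 1) * psi G < psi (integer_mod_group (order G))"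
    by (simp add: psi_integer_mod_group)
  then have "real (q - 1) * real (psi G) < real (psi (integer_mod_group (order G)))"
    by (simp only: of_nat_mult[symmetric] of_nat_less_iff)
  then show ?thesis using q by (simp add: pos_less_divide_eq mult.commute)
qed

end
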